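(* There is an absolute constant $c>0$ such that for every convex polynomial cost function $g:\mathbb{R}_+^n\to\mathbb{R}_+$ with non-negative coefficients, $g(\vec 0)=0$ and maximum degree $\tau\ge1$, there is a $c\,\tau$-competitive online algorithm for the online convex packing problem with cost function $g$ (on instances whose offline optimum is finite).
   Context: Online convex packing problem with cost function $g:\mathbb{R}_+^n\to\mathbb{R}_+$ (known in advance): in round $k=1,\dots,m$ a vector $\vec a_k\in\mathbb{R}_+^n$ arrives, and the algorithm must immediately and irrevocably choose $y_k\ge0$ without knowledge of future vectors (or of $m$). Let $A$ be the $m\times n$ matrix with rows $\vec a_k$, and for $\vec y\in\mathbb{R}_+^m$ let $P(\vec y)=\sum_{j=1}^m y_j-g(A^T\vec y)$. Let $P^{\mathrm{opt}}=\sup_{\vec y\in\mathbb{R}_+^m}P(\vec y)$, assumed finite. The algorithm is $\alpha$-competitive if for every instance with finite $P^{\mathrm{opt}}$ its output satisfies $P^{\mathrm{opt}}\le\alpha\cdot P(\vec y)$. *)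

theory Defs
  imports "HOL-Analysis.Analysis" "HOL-Analysis.Finite_Function_Topology"
begin

text \<open>
  The dimension \<open>n\<close> has to be a term rather than a type, since the competitive ratio must involve
  a constant independent of it.  A vector of \<open>\<real>^n\<close> is therefore a finitely supported function
  whose support lies in \<open>{..<n}\<close>; these form a real vector space, so that
  \<^const>\<open>convex_on\<close> applies to them.
\<close>

type_synonym rvec = "nat \<Rightarrow>\<^sub>0 real"

definition nonneg_orthant :: "nat \<Rightarrow> rvec set" where
  "nonneg_orthant n =
     {x. Poly_Mapping.keys x \<subseteq> {..<n} \<and> (\<forall>i<n. 0 \<le> Poly_Mapping.lookup x i)}"

text \<open>
  Real polynomials in the variables \<open>x\<^sub>0, x\<^sub>1, \<dots>\<close>: a monomial is its exponent vector, and a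
  polynomial is the finitely supported family of its coefficients.
\<close>

type_synonym monomial = "nat \<Rightarrow>\<^sub>0 nat"
type_synonym rpoly = "monomial \<Rightarrow>\<^sub>0 real"

definition monomial_degree :: "monomial \<Rightarrow> nat" where
  "monomial_degree e = (\<Sum>i\<in>Poly_Mapping.keys e. Poly_Mapping.lookup e i)"

definition eval_monomial :: "monomial \<Rightarrow> rvec \<Rightarrow> real" where
  "eval_monomial e x =
     (\<Prod>i\<in>Poly_Mapping.keys e. Poly_Mapping.lookup x i ^ Poly_Mapping.lookup e i)"

definition eval_rpoly :: "rpoly \<Rightarrow> rvec \<Rightarrow> real" where
  "eval_rpoly p x = (\<Sum>e\<in>Poly_Mapping.keys p. Poly_Mapping.lookup p e * eval_monomial e x)"

definition rpoly_in_vars :: "nat \<Rightarrow> rpoly \<Rightarrow> bool" where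
  "rpoly_in_vars n p \<longleftrightarrow> (\<forall>e\<in>Poly_Mapping.keys p. Poly_Mapping.keys e \<subseteq> {..<n})"

text \<open>The total degree; inserting 0 gives the zero polynomial degree 0.\<close>

definition max_degree :: "rpoly \<Rightarrow> nat" where
  "max_degree p = Max (insert 0 (monomial_degree ` Poly_Mapping.keys p))"

text \<open>
  An instance is the list \<open>as\<close> of its rows, in order of arrival, and \<open>row_combination as y\<close> is
  \<open>A\<^sup>T y\<close> for the matrix \<open>A\<close> with these rows.
\<close>

definition row_combination :: "rvec list \<Rightarrow> real list \<Rightarrow> rvec" where
  "row_combination as y = (\<Sum>k<length as. (y ! k) *\<^sub>R (as ! k))"

definition packing_value :: "(rvec \<Rightarrow> real) \<Rightarrow> rvec list \<Rightarrow> real list \<Rightarrow> real" where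
  "packing_value g as y = (\<Sum>k<length as. y ! k) - g (row_combination as y)"

definition packing_opt :: "(rvec \<Rightarrow> real) \<Rightarrow> rvec list \<Rightarrow> ereal" where
  "packing_opt g as =
     (SUP y\<in>{y. length y = length as \<and> (\<forall>v\<in>set y. 0 \<le> v)}. ereal (packing_value g as y))"

text \<open>
  A deterministic online algorithm maps the rows \<open>a\<^sub>1, \<dots>, a\<^sub>k\<close> that have arrived so far to its
  choice \<open>y\<^sub>k\<close>.  Its own earlier choices are determined by the same rows and need not be passed.
\<close>

definition online_algorithm :: "nat \<Rightarrow> (rvec list \<Rightarrow> real) \<Rightarrow> bool" where
  "online_algorithm n alg \<longleftrightarrow>
     (\<forall>as. as \<noteq> [] \<longrightarrow> set as \<subseteq> nonneg_orthant n \<longrightarrow> 0 \<le> alg as)"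

definition online_output :: "(rvec list \<Rightarrow> real) \<Rightarrow> rvec list \<Rightarrow> real list" where
  "online_output alg as = map (\<lambda>k. alg (take (Suc k) as)) [0..<length as]"

definition competitive ::
  "nat \<Rightarrow> (rvec \<Rightarrow> real) \<Rightarrow> real \<Rightarrow> (rvec list \<Rightarrow> real) \<Rightarrow> bool" where
  "competitive n g \<alpha> alg \<longleftrightarrow>
     (\<forall>as. set as \<subseteq> nonneg_orthant n \<longrightarrow> \<bar>packing_opt g as\<bar> \<noteq> \<infinity> \<longrightarrow>
        packing_opt g as \<le> ereal (\<alpha> * packing_value g as (online_output alg as)))"

end

theory Submission
  imports Defs
begin

text \<open>
  Let \<open>z\<close> be the row combination chosen so far.  When a row \<open>a\<close> arrives, the algorithm raises its
  variable \<open>t\<close> until the directional derivative of \<open>g\<close> at the doubled point \<open>2 (z + t a)\<close> along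
  \<open>a\<close> reaches 1.  Since the gradient of \<open>g\<close> is monotone, the gradient at the final doubled point
  \<open>w = 2 z\<close> pays at least 1 for every row, so by weak duality every solution has value at most
  \<open>\<langle>\<nabla>g w, w\<rangle> - g w\<close>.  On the other hand convexity bounds the increase of \<open>g\<close> at the doubled point
  by \<open>2 t\<close> in every round, so the algorithm gains at least \<open>g (2 z) / 2 - g z\<close>.  A monomial \<open>m\<close> of
  degree \<open>d\<close> contributes \<open>(d - 1) 2\<^sup>d m z\<close> to the first bound and \<open>(2\<^sup>d\<^sup>-\<^sup>1 - 1) m z\<close> to the second,
  and the former is at most \<open>4 \<tau>\<close> times the latter if \<open>1 \<le> d \<le> \<tau>\<close>.
\<close>

section \<open>Coordinates and the non-negative orthant\<close>

lemma lookup_scaleR [simp]: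
  fixes x :: "'a \<Rightarrow>\<^sub>0 real"
  shows "Poly_Mapping.lookup (r *\<^sub>R x) i = r * Poly_Mapping.lookup x i"
proof -
  have "finite {i. r *\<^sub>R Poly_Mapping.lookup x i \<noteq> 0}"
    by (rule finite_subset[OF _ finite_keys[of x]]) (auto simp: in_keys_iff)
  then show ?thesis
    by (simp add: scaleR_poly_mapping_def Abs_poly_mapping_inverse)
qed

lemma nonneg_orthant_iff:
  "x \<in> nonneg_orthant n \<longleftrightarrow>
     (\<forall>i. 0 \<le> Poly_Mapping.lookup x i) \<and> (\<forall>i\<ge>n. Poly_Mapping.lookup x i = 0)"
proof -
  have "0 \<le> Poly_Mapping.lookup x i"
    if "\<forall>i. Poly_Mapping.lookup x i \<noteq> 0 \<longrightarrow> i < n" "\<forall>i<n. 0 \<le> Poly_Mapping.lookup x i" for i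
    using that by (cases "Poly_Mapping.lookup x i = 0") auto
  then show ?thesis
    by (auto simp: nonneg_orthant_def in_keys_iff subset_iff) (meson not_le)+
qed

lemma nonneg_orthant_zero [simp]: "0 \<in> nonneg_orthant n"
  by (simp add: nonneg_orthant_iff)

lemma nonneg_orthant_add:
  "x \<in> nonneg_orthant n \<Longrightarrow> y \<in> nonneg_orthant n \<Longrightarrow> x + y \<in> nonneg_orthant n"
  by (simp add: nonneg_orthant_iff lookup_add)

lemma nonneg_orthant_scaleR:
  "x \<in> nonneg_orthant n \<Longrightarrow> 0 \<le> r \<Longrightarrow> r *\<^sub>R x \<in> nonneg_orthant n"
  by (simp add: nonneg_orthant_iff)

lemma nonneg_orthant_sum:
  "(\<And>i. i \<in> I \<Longrightarrow> f i \<in> nonneg_orthant n) \<Longrightarrow> sum f I \<in> nonneg_orthant n"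
  by (induction I rule: infinite_finite_induct) (simp_all add: nonneg_orthant_add)

lemma nonneg_orthant_row_combination:
  assumes "set as \<subseteq> nonneg_orthant n" "\<And>k. k < length as \<Longrightarrow> 0 \<le> y ! k"
  shows "row_combination as y \<in> nonneg_orthant n"
  unfolding row_combination_def
  using assms by (intro nonneg_orthant_sum nonneg_orthant_scaleR) (auto dest: nth_mem)

section \<open>Directional derivatives of polynomials\<close>

text \<open>This is the gradient of the monomial at \<open>v\<close> paired with \<open>u\<close>,
  expanded by the product rule. The exponent \<open>lookup e i - 1\<close> never truncates, since
  \<open>i\<close> ranges over the keys of \<open>e\<close>.\<close>

definition dir_deriv_monomial :: "monomial \<Rightarrow> rvec \<Rightarrow> rvec \<Rightarrow> real" where
  "dir_deriv_monomial e v u =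
     (\<Sum>i\<in>Poly_Mapping.keys e.
        real (Poly_Mapping.lookup e i) * Poly_Mapping.lookup v i ^ (Poly_Mapping.lookup e i - 1)
          * Poly_Mapping.lookup u i
          * (\<Prod>j\<in>Poly_Mapping.keys e - {i}. Poly_Mapping.lookup v j ^ Poly_Mapping.lookup e j))"

definition dir_deriv :: "rpoly \<Rightarrow> rvec \<Rightarrow> rvec \<Rightarrow> real" where
  "dir_deriv p v u =
     (\<Sum>e\<in>Poly_Mapping.keys p. Poly_Mapping.lookup p e * dir_deriv_monomial e v u)"

lemma has_field_derivative_eval_monomial:
  "((\<lambda>s. eval_monomial e (v + s *\<^sub>R u)) has_field_derivative dir_deriv_monomial e v u) (at 0)"
  unfolding eval_monomial_def lookup_add lookup_scaleR
  by (rule DERIV_cong[OF has_field_derivative_prod])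
    (auto intro!: derivative_eq_intros simp: dir_deriv_monomial_def)

lemma has_field_derivative_eval_rpoly:
  "((\<lambda>s. eval_rpoly p (v + s *\<^sub>R u)) has_field_derivative dir_deriv p v u) (at 0)"
  unfolding eval_rpoly_def dir_deriv_def
  by (intro DERIV_sum DERIV_cmult has_field_derivative_eval_monomial)

lemma continuous_dir_deriv_line: "continuous_on S (\<lambda>t. dir_deriv p (v + t *\<^sub>R u) a)"
  unfolding dir_deriv_def dir_deriv_monomial_def lookup_add lookup_scaleR
  by (intro continuous_intros)

lemma dir_deriv_add: "dir_deriv p v (x + y) = dir_deriv p v x + dir_deriv p v y"
  by (simp add: dir_deriv_def dir_deriv_monomial_def lookup_add distrib_left distrib_right
      sum.distrib)

lemma dir_deriv_scaleR: "dir_deriv p v (r *\<^sub>R x) = r * dir_deriv p v x"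
  by (simp add: dir_deriv_def dir_deriv_monomial_def sum_distrib_left mult_ac)

lemma linear_dir_deriv: "linear (dir_deriv p v)"
  by (rule linearI) (simp_all add: dir_deriv_add dir_deriv_scaleR)

lemma dir_deriv_monomial_mono:
  assumes "\<And>i. 0 \<le> Poly_Mapping.lookup v i"
    and "\<And>i. Poly_Mapping.lookup v i \<le> Poly_Mapping.lookup w i"
    and "\<And>i. 0 \<le> Poly_Mapping.lookup a i"
  shows "dir_deriv_monomial e v a \<le> dir_deriv_monomial e w a"
proof -
  have "0 \<le> Poly_Mapping.lookup w i" for i
    using assms(1,2) order_trans by blast
  then show ?thesis
    unfolding dir_deriv_monomial_def
    using assms by (intro sum_mono mult_mono prod_mono power_mono conjI prod_nonneg mult_nonneg_nonneg) auto
qed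

text \<open>With non-negative coefficients and a non-negative direction, every summand is a product
  of non-negative factors that grow with each coordinate of the base point.\<close>

lemma dir_deriv_mono:
  assumes "\<And>e. 0 \<le> Poly_Mapping.lookup p e"
    and "\<And>i. 0 \<le> Poly_Mapping.lookup v i"
    and "\<And>i. Poly_Mapping.lookup v i \<le> Poly_Mapping.lookup w i"
    and "\<And>i. 0 \<le> Poly_Mapping.lookup a i"
  shows "dir_deriv p v a \<le> dir_deriv p w a"
  unfolding dir_deriv_def
  using assms by (intro sum_mono mult_left_mono dir_deriv_monomial_mono) auto

text \<open>Euler's identity for homogeneous functions: multiplying the \<open>i\<close>-th partial
  derivative by the \<open>i\<close>-th coordinate restores the lost power, so the exponents add up
  to the degree.\<close>

lemma euler_monomial:
  "dir_deriv_monomial e v v = real (monomial_degree e) * eval_monomial e v"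
proof -
  have "real (Poly_Mapping.lookup e i) * Poly_Mapping.lookup v i ^ (Poly_Mapping.lookup e i - 1)
          * Poly_Mapping.lookup v i
          * (\<Prod>j\<in>Poly_Mapping.keys e - {i}. Poly_Mapping.lookup v j ^ Poly_Mapping.lookup e j)
        = real (Poly_Mapping.lookup e i) * eval_monomial e v"
    if i: "i \<in> Poly_Mapping.keys e" for i
  proof -
    have "Poly_Mapping.lookup v i ^ (Poly_Mapping.lookup e i - 1) * Poly_Mapping.lookup v i
        = Poly_Mapping.lookup v i ^ Poly_Mapping.lookup e i"
      using i by (intro power_minus_mult) (simp add: in_keys_iff)
    then show ?thesis
      unfolding eval_monomial_def prod.remove[OF finite_keys i] by (simp add: mult.assoc)
  qed
  then have "dir_deriv_monomial e v v
      = (\<Sum>i\<in>Poly_Mapping.keys e. real (Poly_Mapping.lookup e i) * eval_monomial e v)"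
    unfolding dir_deriv_monomial_def by (rule sum.cong[OF refl])
  then show ?thesis
    by (simp add: monomial_degree_def sum_distrib_right)
qed

lemma eval_monomial_scaleR:
  "eval_monomial e (r *\<^sub>R v) = r ^ monomial_degree e * eval_monomial e v"
  by (simp add: eval_monomial_def monomial_degree_def power_mult_distrib prod.distrib power_sum)

lemma eval_monomial_nonneg:
  "(\<And>i. 0 \<le> Poly_Mapping.lookup v i) \<Longrightarrow> 0 \<le> eval_monomial e v"
  by (simp add: eval_monomial_def prod_nonneg)

text \<open>Only the constant monomial survives at the origin, so the value there is the constant
  coefficient, and its vanishing leaves monomials of positive degree.\<close>

lemma monomial_degree_pos:
  assumes "eval_rpoly p 0 = 0" "e \<in> Poly_Mapping.keys p"
  shows "1 \<le> monomial_degree e"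
proof -
  have eval_0: "eval_monomial d 0 = (if d = 0 then 1 else 0)" for d
  proof (cases "d = 0")
    case False
    then obtain i where "i \<in> Poly_Mapping.keys d"
      by (metis keys_eq_empty ex_in_conv)
    with False show ?thesis
      unfolding eval_monomial_def by (auto simp: in_keys_iff intro!: prod_zero)
  qed (simp add: eval_monomial_def)
  have "eval_rpoly p 0 = Poly_Mapping.lookup p 0"
    unfolding eval_rpoly_def eval_0 by (simp add: if_distrib in_keys_iff cong: if_cong)
  then have "e \<noteq> 0"
    using assms by (auto simp: in_keys_iff)
  then obtain i where i: "i \<in> Poly_Mapping.keys e"
    by (metis keys_eq_empty ex_in_conv)
  then have "1 \<le> Poly_Mapping.lookup e i"
    by (simp add: in_keys_iff)
  also have "\<dots> \<le> monomial_degree e"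
    unfolding monomial_degree_def by (rule member_le_sum) (use i in auto)
  finally show ?thesis .
qed

lemma monomial_degree_le_max_degree:
  "e \<in> Poly_Mapping.keys p \<Longrightarrow> monomial_degree e \<le> max_degree p"
  by (simp add: max_degree_def)

text \<open>Convexity bounds the difference quotients along the segment by the chord slope. The
  limit is taken from the right, because only \<open>s\<close> between 0 and 1 is known to stay in
  \<open>C\<close>.\<close>

lemma convex_gradient_inequality:
  assumes conv: "convex_on C (eval_rpoly p)" and v: "v \<in> C" and u: "u \<in> C"
  shows "eval_rpoly p v + dir_deriv p v (u - v) \<le> eval_rpoly p u"
proof -
  let ?f = "\<lambda>s. eval_rpoly p (v + s *\<^sub>R (u - v))"
  have "((\<lambda>s. (?f s - ?f 0) / s) \<longlongrightarrow> dir_deriv p v (u - v)) (at 0)"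
    using has_field_derivative_eval_rpoly[of p v "u - v"] by (simp add: DERIV_def)
  then have lim: "((\<lambda>s. (?f s - ?f 0) / s) \<longlongrightarrow> dir_deriv p v (u - v)) (at_right 0)"
    by (rule tendsto_mono[OF at_le, rotated]) simp
  have "\<forall>\<^sub>F s in at_right (0::real). s \<in> {0<..<1}"
    by (rule eventually_at_right_real) simp
  then have "\<forall>\<^sub>F s in at_right 0. (?f s - ?f 0) / s \<le> eval_rpoly p u - eval_rpoly p v"
  proof eventually_elim
    case (elim s)
    have "?f s \<le> (1 - s) * eval_rpoly p v + s * eval_rpoly p u"
      using convex_onD[OF conv, of s v u] elim v u by (simp add: algebra_simps)
    with elim show ?case
      by (simp add: field_simps)
  qed
  from tendsto_upperbound[OF lim this] show ?thesis
    by simp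
qed

section \<open>Primal and dual bounds\<close>

text \<open>Weak duality: the gradient at \<open>w\<close> prices every row at 1 or more, and the
  right-hand side is the convex conjugate of the cost at that gradient.\<close>

lemma packing_value_le_dual:
  assumes conv: "convex_on (nonneg_orthant n) (eval_rpoly p)"
    and as: "set as \<subseteq> nonneg_orthant n" and w: "w \<in> nonneg_orthant n"
    and feasible: "\<And>a. a \<in> set as \<Longrightarrow> 1 \<le> dir_deriv p w a"
    and y: "\<And>k. k < length as \<Longrightarrow> 0 \<le> y ! k"
  shows "packing_value (eval_rpoly p) as y \<le> dir_deriv p w w - eval_rpoly p w"
proof -
  let ?x = "row_combination as y"
  have "(\<Sum>k<length as. y ! k) \<le> (\<Sum>k<length as. y ! k * dir_deriv p w (as ! k))"
    using y feasible by (intro sum_mono) (simp add: mult_le_cancel_left1 leD)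
  also have "\<dots> = dir_deriv p w ?x"
    by (simp add: row_combination_def linear_sum[OF linear_dir_deriv] dir_deriv_scaleR)
  also have "\<dots> = dir_deriv p w w + dir_deriv p w (?x - w)"
    by (simp flip: dir_deriv_add)
  also have "\<dots> \<le> dir_deriv p w w - eval_rpoly p w + eval_rpoly p ?x"
    using convex_gradient_inequality[OF conv w nonneg_orthant_row_combination[OF as y]] by simp
  finally show ?thesis
    by (simp add: packing_value_def)
qed

text \<open>The gradient inequality is applied at the far end of the step, since that is where the
  stopping rule controls the slope.\<close>

lemma eval_rpoly_ray_increase:
  assumes conv: "convex_on (nonneg_orthant n) (eval_rpoly p)"
    and z: "z \<in> nonneg_orthant n" and a: "a \<in> nonneg_orthant n" and t: "0 \<le> t"
  shows "eval_rpoly p (z + t *\<^sub>R a) \<le> eval_rpoly p z + t * dir_deriv p (z + t *\<^sub>R a) a"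
proof -
  have "dir_deriv p (z + t *\<^sub>R a) (- (t *\<^sub>R a)) = - (t * dir_deriv p (z + t *\<^sub>R a) a)"
    using dir_deriv_scaleR[of p _ "- t" a] by simp
  with convex_gradient_inequality[OF conv _ z, of "z + t *\<^sub>R a"] show ?thesis
    using z a t by (simp add: nonneg_orthant_add nonneg_orthant_scaleR)
qed

text \<open>Both sides vanish for \<open>d = 1\<close>. For larger \<open>d\<close>,
  \<open>2 ^ d / 2 - 1\<close> is at least a quarter of \<open>2 ^ d\<close>, whence the factor
  4.\<close>

lemma degree_arithmetic:
  assumes "1 \<le> d" "d \<le> \<tau>"
  shows "(real d - 1) * 2 ^ d \<le> 4 * real \<tau> * (2 ^ d / 2 - 1)"
proof (cases "d = 1")
  case False
  with assms obtain k where d: "d = Suc (Suc k)"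
    by (metis One_nat_def Suc_le_D not0_implies_Suc)
  have "(real d - 1) * 2 ^ d \<le> real \<tau> * 2 ^ d"
    using assms by (intro mult_right_mono) auto
  also have "\<dots> = 4 * real \<tau> * 2 ^ k"
    by (simp add: d)
  also have "\<dots> \<le> 4 * real \<tau> * (2 ^ d / 2 - 1)"
    by (intro mult_left_mono) (use one_le_power[of "2::real" k] in \<open>auto simp: d\<close>)
  finally show ?thesis .
qed simp

text \<open>Euler's identity and homogeneity express both sides through the values of the monomials
  at \<open>z\<close>, which are then compared one by one.\<close>

lemma dual_le_primal:
  assumes nonneg: "\<And>e. 0 \<le> Poly_Mapping.lookup p e" and zero: "eval_rpoly p 0 = 0"
    and z: "z \<in> nonneg_orthant n"
  shows "dir_deriv p (2 *\<^sub>R z) (2 *\<^sub>R z) - eval_rpoly p (2 *\<^sub>R z)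
     \<le> 4 * real (max_degree p) * (eval_rpoly p (2 *\<^sub>R z) / 2 - eval_rpoly p z)"
proof -
  let ?c = "\<lambda>e. Poly_Mapping.lookup p e * eval_monomial e z"
  have "dir_deriv p (2 *\<^sub>R z) (2 *\<^sub>R z) - eval_rpoly p (2 *\<^sub>R z)
      = (\<Sum>e\<in>Poly_Mapping.keys p. ?c e * ((real (monomial_degree e) - 1) * 2 ^ monomial_degree e))"
    by (simp add: dir_deriv_def eval_rpoly_def euler_monomial eval_monomial_scaleR algebra_simps
        flip: sum_subtractf)
  also have "\<dots> \<le> (\<Sum>e\<in>Poly_Mapping.keys p.
      ?c e * (4 * real (max_degree p) * (2 ^ monomial_degree e / 2 - 1)))"
    using nonneg z
    by (intro sum_mono mult_left_mono degree_arithmetic monomial_degree_pos[OF zero]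
        monomial_degree_le_max_degree mult_nonneg_nonneg eval_monomial_nonneg)
      (auto simp: nonneg_orthant_iff)
  also have "\<dots> = 4 * real (max_degree p) * (eval_rpoly p (2 *\<^sub>R z) / 2 - eval_rpoly p z)"
    by (simp add: eval_rpoly_def eval_monomial_scaleR algebra_simps sum_distrib_left
        sum_divide_distrib flip: sum_subtractf)
  finally show ?thesis .
qed

section \<open>Unbounded instances\<close>

text \<open>
  If the slope along \<open>a\<close> stays below 1, no monomial of degree at least 2 is active on this ray.
\<close>

lemma ray_cost_linear:
  assumes nonneg: "\<And>e. 0 \<le> Poly_Mapping.lookup p e" and zero: "eval_rpoly p 0 = 0"
    and a: "a \<in> nonneg_orthant n"
    and slope: "\<And>t. 0 \<le> t \<Longrightarrow> dir_deriv p (t *\<^sub>R a) a < 1"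
  shows "eval_rpoly p (t *\<^sub>R a) = t * eval_rpoly p a" and "eval_rpoly p a < 1"
proof -
  let ?c = "\<lambda>e. Poly_Mapping.lookup p e * eval_monomial e a"
  let ?d = monomial_degree
  have c: "0 \<le> ?c e" for e
    using nonneg a by (auto simp: nonneg_orthant_iff intro!: mult_nonneg_nonneg eval_monomial_nonneg)
  have high: "?c e = 0" if e: "e \<in> Poly_Mapping.keys p" and d: "2 \<le> ?d e" for e
  proof (rule ccontr)
    assume "?c e \<noteq> 0"
    with c[of e] have pos: "0 < ?c e" by linarith
    \<comment> \<open>Chosen so that both \<open>s\<close> and \<open>?c e * s\<close> exceed 1.
      This single monomial then already pushes the derivative at \<open>s *\<^sub>R a\<close> along
      itself above \<open>s\<close>, against the slope bound.\<close>
    define s where "s = 1 + 1 / ?c e"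
    have s: "1 < s" using pos by (simp add: s_def)
    have "?c e * s = ?c e + 1"
      using pos unfolding s_def by (metis distrib_left less_irrefl mult.right_neutral nonzero_eq_divide_eq mult.commute)
    then have "s < s * (?c e * s)"
      using pos s by (simp add: mult_less_cancel_left1)
    also have "s * (?c e * s) = ?c e * (1 * s ^ 2)"
      by (simp add: power2_eq_square)
    also have "\<dots> \<le> ?c e * (real (?d e) * s ^ ?d e)"
      using pos s d by (intro mult_left_mono mult_mono power_increasing) auto
    also have "\<dots> \<le> (\<Sum>e\<in>Poly_Mapping.keys p. ?c e * (real (?d e) * s ^ ?d e))"
      by (rule member_le_sum[OF e]) (use c s in auto)
    also have "\<dots> = dir_deriv p (s *\<^sub>R a) (s *\<^sub>R a)"
      by (simp add: dir_deriv_def euler_monomial eval_monomial_scaleR mult_ac)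
    also have "\<dots> < s * 1"
      unfolding dir_deriv_scaleR using slope[of s] s by (intro mult_strict_left_mono) auto
    finally show False by simp
  qed
  \<comment> \<open>Every monomial is either zero at \<open>a\<close> or has degree exactly
    1.\<close>
  have active: "?c e * t ^ ?d e = t * ?c e" "?c e * real (?d e) = ?c e"
    if "e \<in> Poly_Mapping.keys p" for e and t :: real
    using high[OF that] monomial_degree_pos[OF zero that] by (cases "?d e = 1"; force)+
  have "eval_rpoly p (t *\<^sub>R a) = (\<Sum>e\<in>Poly_Mapping.keys p. ?c e * t ^ ?d e)"
    by (simp add: eval_rpoly_def eval_monomial_scaleR mult_ac)
  also have "\<dots> = t * eval_rpoly p a"
    by (simp only: active eval_rpoly_def sum_distrib_left cong: sum.cong)
  finally show "eval_rpoly p (t *\<^sub>R a) = t * eval_rpoly p a" .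
  have "eval_rpoly p a = (\<Sum>e\<in>Poly_Mapping.keys p. ?c e * real (?d e))"
    by (simp only: active eval_rpoly_def cong: sum.cong)
  also have "\<dots> = dir_deriv p (1 *\<^sub>R a) a"
    by (simp add: dir_deriv_def euler_monomial mult_ac)
  also have "\<dots> < 1"
    by (rule slope) simp
  finally show "eval_rpoly p a < 1" .
qed

lemma packing_value_single:
  assumes "k < length as"
  shows "packing_value g as ((replicate (length as) 0)[k := t]) = t - g (t *\<^sub>R (as ! k))"
proof -
  have "((replicate (length as) 0)[k := t]) ! j = (if j = k then t else 0)"
    if "j < length as" for j
    using that assms by (simp add: nth_list_update)
  then show ?thesis
    using assms
    by (simp add: packing_value_def row_combination_def if_distrib[of "\<lambda>x. x *\<^sub>R _"] cong: if_cong)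
qed

text \<open>The case \<open>t = 0\<close> covers rows whose slope is already at least 1 on arrival.
  In both cases \<open>t\<close> times the final slope equals \<open>t\<close>.\<close>

definition stopping_point :: "rpoly \<Rightarrow> rvec \<Rightarrow> rvec \<Rightarrow> real \<Rightarrow> bool" where
  "stopping_point p z a t \<longleftrightarrow> 0 \<le> t \<and> 1 \<le> dir_deriv p (2 *\<^sub>R (z + t *\<^sub>R a)) a \<and>
     (t = 0 \<or> dir_deriv p (2 *\<^sub>R (z + t *\<^sub>R a)) a = 1)"

text \<open>By the intermediate value theorem, a slope that starts at most 1 and gets to 1 or beyond
  takes the value 1 somewhere, and that would be a stopping point.\<close>

lemma slope_less_one:
  assumes none: "\<And>t. \<not> stopping_point p z a t" and t: "0 \<le> t"
  shows "dir_deriv p (2 *\<^sub>R (z + t *\<^sub>R a)) a < 1"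
proof (rule ccontr)
  let ?q = "\<lambda>t. dir_deriv p (2 *\<^sub>R (z + t *\<^sub>R a)) a"
  assume "\<not> ?q t < 1"
  then have "1 \<le> ?q t" by simp
  moreover have "?q 0 \<le> 1"
    using none[of 0] by (auto simp: stopping_point_def)
  moreover have "continuous_on {0..t} ?q"
  proof -
    have "2 *\<^sub>R (z + s *\<^sub>R a) = 2 *\<^sub>R z + s *\<^sub>R (2 *\<^sub>R a)" for s
      by (simp add: scaleR_add_right)
    then show ?thesis
      by (simp only: continuous_dir_deriv_line)
  qed
  ultimately obtain s where "0 \<le> s" "?q s = 1"
    using IVT'[of ?q 0 1 t] t by auto
  with none[of s] show False
    by (simp add: stopping_point_def)
qed

text \<open>Without a stopping point, the cost along the ray of the row is linear with slope below
  1. Raising that one variable alone would then give unbounded profit, against the finite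
  optimum.\<close>

lemma stopping_point_exists:
  assumes nonneg: "\<And>e. 0 \<le> Poly_Mapping.lookup p e" and zero: "eval_rpoly p 0 = 0"
    and as: "set as \<subseteq> nonneg_orthant n" and finite: "\<bar>packing_opt (eval_rpoly p) as\<bar> \<noteq> \<infinity>"
    and k: "k < length as" and z: "z \<in> nonneg_orthant n"
  shows "\<exists>t. stopping_point p z (as ! k) t"
proof (rule ccontr)
  let ?a = "as ! k"
  assume none: "\<nexists>t. stopping_point p z ?a t"
  have a: "?a \<in> nonneg_orthant n"
    using as k by auto
  have "dir_deriv p (t *\<^sub>R ?a) ?a < 1" if "0 \<le> t" for t
  proof -
    have "dir_deriv p (t *\<^sub>R ?a) ?a \<le> dir_deriv p (2 *\<^sub>R (z + t *\<^sub>R ?a)) ?a"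
      using a z that by (intro dir_deriv_mono nonneg) (auto simp: nonneg_orthant_iff lookup_add)
    also have "\<dots> < 1"
      using none that by (intro slope_less_one) auto
    finally show ?thesis .
  qed
  note ray = ray_cost_linear[OF nonneg zero a this]
  obtain M where M: "packing_opt (eval_rpoly p) as = ereal M"
    using finite by auto
  \<comment> \<open>Makes the profit of the single-variable solution exactly
    \<open>\<bar>M\<bar> + 1\<close>, which exceeds the optimum \<open>M\<close>.\<close>
  define t where "t = (\<bar>M\<bar> + 1) / (1 - eval_rpoly p ?a)"
  have "0 \<le> t"
    using ray(2) by (simp add: t_def)
  then have "ereal (packing_value (eval_rpoly p) as ((replicate (length as) 0)[k := t]))
      \<le> packing_opt (eval_rpoly p) as"
    unfolding packing_opt_def
    by (intro SUP_upper) (auto dest!: set_update_subset_insert[THEN subsetD])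
  then have "t * (1 - eval_rpoly p ?a) \<le> M"
    by (simp add: packing_value_single[OF k] ray(1) M algebra_simps)
  moreover have "t * (1 - eval_rpoly p ?a) = \<bar>M\<bar> + 1"
    using ray(2) by (simp add: t_def)
  ultimately show False
    by simp
qed

section \<open>The online algorithm\<close>

text \<open>The default 0 keeps the choice non-negative when no stopping point exists, as can happen
  on unbounded instances.\<close>

definition increment :: "rpoly \<Rightarrow> rvec \<Rightarrow> rvec \<Rightarrow> real" where
  "increment p z a =
     (if \<exists>t. stopping_point p z a t then SOME t. stopping_point p z a t else 0)"

text \<open>Recomputes the current row combination from the rows alone, as an online algorithm
  receives only those.\<close>

definition load :: "rpoly \<Rightarrow> rvec list \<Rightarrow> rvec" where
  "load p = foldl (\<lambda>z a. z + increment p z a *\<^sub>R a) 0"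

definition packing_alg :: "rpoly \<Rightarrow> rvec list \<Rightarrow> real" where
  "packing_alg p as = increment p (load p (butlast as)) (last as)"

lemma stopping_point_increment:
  "\<exists>t. stopping_point p z a t \<Longrightarrow> stopping_point p z a (increment p z a)"
  by (simp add: increment_def someI_ex)

lemma increment_nonneg: "0 \<le> increment p z a"
proof (cases "\<exists>t. stopping_point p z a t")
  case True
  then show ?thesis
    using stopping_point_increment[OF True] by (simp add: stopping_point_def)
qed (simp add: increment_def)

lemma load_take_Suc:
  assumes "k < length as"
  shows "load p (take (Suc k) as) =
    load p (take k as) + increment p (load p (take k as)) (as ! k) *\<^sub>R (as ! k)"
  by (simp add: load_def take_Suc_conv_app_nth[OF assms])

lemma nth_online_output:
  assumes "k < length as"
  shows "online_output (packing_alg p) as ! k = increment p (load p (take k as)) (as ! k)"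
  using assms by (simp add: online_output_def packing_alg_def take_Suc_conv_app_nth)

lemma load_take_eq_sum:
  "k \<le> length as \<Longrightarrow>
     load p (take k as) = (\<Sum>j<k. (online_output (packing_alg p) as ! j) *\<^sub>R (as ! j))"
proof (induction k)
  case (Suc k)
  then show ?case
    by (simp add: load_take_Suc nth_online_output)
qed (simp add: load_def)

lemma row_combination_online_output:
  "row_combination as (online_output (packing_alg p) as) = load p as"
  using load_take_eq_sum[of "length as" as p] by (simp add: row_combination_def)

lemma load_nonneg:
  assumes "set as \<subseteq> nonneg_orthant n"
  shows "load p as \<in> nonneg_orthant n"
  unfolding row_combination_online_output[symmetric]
  using assms by (intro nonneg_orthant_row_combination) (simp_all add: nth_online_output increment_nonneg)

lemma load_take_nonneg:
  "set as \<subseteq> nonneg_orthant n \<Longrightarrow> load p (take k as) \<in> nonneg_orthant n"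
  by (meson load_nonneg order_trans set_take_subset)

lemma lookup_load_take_mono:
  assumes "set as \<subseteq> nonneg_orthant n" "k \<le> length as"
  shows "Poly_Mapping.lookup (load p (take k as)) i \<le> Poly_Mapping.lookup (load p as) i"
proof -
  have "(\<Sum>j<k. Poly_Mapping.lookup ((online_output (packing_alg p) as ! j) *\<^sub>R (as ! j)) i)
      \<le> (\<Sum>j<length as. Poly_Mapping.lookup ((online_output (packing_alg p) as ! j) *\<^sub>R (as ! j)) i)"
  proof (rule sum_mono2)
    fix j assume "j \<in> {..<length as} - {..<k}"
    then have j: "j < length as" by simp
    then have "as ! j \<in> nonneg_orthant n"
      using assms(1) by auto
    with j show "0 \<le> Poly_Mapping.lookup ((online_output (packing_alg p) as ! j) *\<^sub>R (as ! j)) i"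
      by (simp add: nth_online_output increment_nonneg nonneg_orthant_iff)
  qed (use assms in auto)
  then show ?thesis
    using load_take_eq_sum[of k as p] load_take_eq_sum[of "length as" as p] assms(2)
    by (simp add: lookup_sum)
qed

text \<open>Invariant over the rounds: choosing \<open>t\<close> moves the doubled load by
  \<open>2 * t\<close> along the row, which costs at most \<open>2 * t\<close> by the stopping
  rule.\<close>

lemma cost_of_doubled_load:
  assumes conv: "convex_on (nonneg_orthant n) (eval_rpoly p)" and zero: "eval_rpoly p 0 = 0"
    and as: "set as \<subseteq> nonneg_orthant n"
    and stop: "\<And>k. k < length as \<Longrightarrow> \<exists>t. stopping_point p (load p (take k as)) (as ! k) t"
  shows "k \<le> length as \<Longrightarrow>
    eval_rpoly p (2 *\<^sub>R load p (take k as)) \<le> 2 * (\<Sum>j<k. online_output (packing_alg p) as ! j)"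
proof (induction k)
  case (Suc k)
  then have k: "k < length as" by simp
  define z where "z = load p (take k as)"
  define t where "t = increment p z (as ! k)"
  have stop_t: "stopping_point p z (as ! k) t"
    unfolding t_def by (rule stopping_point_increment) (use stop[OF k] in \<open>simp add: z_def\<close>)
  then have t: "0 \<le> t"
    by (simp add: stopping_point_def)
  have a: "as ! k \<in> nonneg_orthant n"
    using as k by auto
  have z: "2 *\<^sub>R z \<in> nonneg_orthant n"
    unfolding z_def by (intro nonneg_orthant_scaleR load_take_nonneg as) simp
  have eq: "2 *\<^sub>R z + (2 * t) *\<^sub>R (as ! k) = 2 *\<^sub>R (z + t *\<^sub>R (as ! k))"
    by (simp add: scaleR_add_right)
  have "eval_rpoly p (2 *\<^sub>R load p (take (Suc k) as)) = eval_rpoly p (2 *\<^sub>R z + (2 * t) *\<^sub>R (as ! k))"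
    unfolding load_take_Suc[OF k] eq by (simp add: z_def t_def)
  also have "\<dots> \<le> eval_rpoly p (2 *\<^sub>R z)
      + 2 * t * dir_deriv p (2 *\<^sub>R z + (2 * t) *\<^sub>R (as ! k)) (as ! k)"
    by (intro eval_rpoly_ray_increase[OF conv z a]) (use t in simp)
  \<comment> \<open>Either \<open>t\<close> is 0 or the slope is exactly 1.\<close>
  also have "\<dots> = eval_rpoly p (2 *\<^sub>R z) + 2 * t"
    using stop_t unfolding stopping_point_def eq by auto
  also have "\<dots> \<le> 2 * (\<Sum>j<Suc k. online_output (packing_alg p) as ! j)"
    using Suc k by (simp add: nth_online_output z_def t_def)
  finally show ?case .
qed (simp add: load_def zero)

lemma packing_alg_competitive:
  assumes nonneg: "\<And>e. 0 \<le> Poly_Mapping.lookup p e"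
    and conv: "convex_on (nonneg_orthant n) (eval_rpoly p)" and zero: "eval_rpoly p 0 = 0"
  shows "competitive n (eval_rpoly p) (4 * real (max_degree p)) (packing_alg p)"
  unfolding competitive_def
proof (intro allI impI)
  fix as
  assume as: "set as \<subseteq> nonneg_orthant n"
    and finite: "\<bar>packing_opt (eval_rpoly p) as\<bar> \<noteq> \<infinity>"
  define z where "z = load p as"
  let ?w = "2 *\<^sub>R z"
  let ?out = "online_output (packing_alg p) as"
  have z: "z \<in> nonneg_orthant n"
    unfolding z_def by (rule load_nonneg[OF as])
  have stop: "\<exists>t. stopping_point p (load p (take k as)) (as ! k) t" if "k < length as" for k
    by (intro stopping_point_exists[OF nonneg zero as finite that] load_take_nonneg as)
  \<comment> \<open>The slope is at least 1 right after the round of \<open>a\<close>. Later rounds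
    only enlarge the load, so monotonicity carries the bound to the final point.\<close>
  have feasible: "1 \<le> dir_deriv p ?w a" if a_in: "a \<in> set as" for a
  proof -
    obtain k where k: "k < length as" and a: "a = as ! k"
      using a_in by (metis in_set_conv_nth)
    have "1 \<le> dir_deriv p (2 *\<^sub>R load p (take (Suc k) as)) a"
      using stopping_point_increment[OF stop[OF k]] k
      by (simp add: stopping_point_def a load_take_Suc)
    also have "\<dots> \<le> dir_deriv p ?w a"
      using load_take_nonneg[OF as, of p "Suc k"] lookup_load_take_mono[OF as, of "Suc k" p] as a_in k
      by (intro dir_deriv_mono nonneg) (auto simp: nonneg_orthant_iff z_def)
    finally show ?thesis .
  qed
  have "dir_deriv p ?w ?w - eval_rpoly p ?w
      \<le> 4 * real (max_degree p) * (eval_rpoly p ?w / 2 - eval_rpoly p z)"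
    by (rule dual_le_primal[OF nonneg zero z])
  also have "\<dots> \<le> 4 * real (max_degree p) * packing_value (eval_rpoly p) as ?out"
    \<comment> \<open>Half the cost at \<open>?w\<close> is at most the sum of the choices, so
      subtracting the cost at \<open>z\<close> gives a lower bound on the algorithm's
      profit.\<close>
    using cost_of_doubled_load[OF conv zero as stop, of "length as"]
    by (intro mult_left_mono) (simp_all add: packing_value_def row_combination_online_output z_def)
  finally have bound: "dir_deriv p ?w ?w - eval_rpoly p ?w
      \<le> 4 * real (max_degree p) * packing_value (eval_rpoly p) as ?out" .
  show "packing_opt (eval_rpoly p) as
      \<le> ereal (4 * real (max_degree p) * packing_value (eval_rpoly p) as ?out)"
    unfolding packing_opt_def
  proof (rule SUP_least)
    fix y :: "real list"
    assume "y \<in> {y. length y = length as \<and> (\<forall>v\<in>set y. 0 \<le> v)}"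
    then have "packing_value (eval_rpoly p) as y \<le> dir_deriv p ?w ?w - eval_rpoly p ?w"
      using as z feasible by (intro packing_value_le_dual[OF conv] nonneg_orthant_scaleR) auto
    with bound show "ereal (packing_value (eval_rpoly p) as y)
        \<le> ereal (4 * real (max_degree p) * packing_value (eval_rpoly p) as ?out)"
      by simp
  qed
qed

theorem theorem1p3:
  shows "\<exists>c::real. c > 0 \<and>
    (\<forall>(n::nat) (\<tau>::nat) (p::rpoly).
       rpoly_in_vars n p \<longrightarrow>
       (\<forall>e. 0 \<le> Poly_Mapping.lookup p e) \<longrightarrow>
       convex_on (nonneg_orthant n) (eval_rpoly p) \<longrightarrow>
       eval_rpoly p 0 = 0 \<longrightarrow>
       max_degree p = \<tau> \<longrightarrow>
       1 \<le> \<tau> \<longrightarrow>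
       (\<exists>alg. online_algorithm n alg \<and> competitive n (eval_rpoly p) (c * real \<tau>) alg))"
\<comment> \<open>The constant 4 is the one from \<open>degree_arithmetic\<close>.\<close>
proof (intro exI[of _ 4] conjI allI impI)
  fix n \<tau> p
  assume "\<forall>e. 0 \<le> Poly_Mapping.lookup p e" "convex_on (nonneg_orthant n) (eval_rpoly p)"
    "eval_rpoly p 0 = 0" "max_degree p = \<tau>"
  then have "competitive n (eval_rpoly p) (4 * real \<tau>) (packing_alg p)"
    using packing_alg_competitive by blast
  moreover have "online_algorithm n (packing_alg p)"
    by (simp add: online_algorithm_def packing_alg_def increment_nonneg)
  ultimately show "\<exists>alg. online_algorithm n alg \<and> competitive n (eval_rpoly p) (4 * real \<tau>) alg"
    by blast
qed simp

end
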